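(* Let $\Gamma$ be a finite quiver and let $D:\mathbf{k}\Gamma\to\mathbf{k}\Gamma$ be a $\mathbf{k}$-linear operator, with $D(p)=\sum_{q\in\mathcal{P}}c^p_q\,q$ for $p\in\mathcal{P}$, $c^p_q\in\mathbf{k}$. Then $D$ is a derivation if and only if it satisfies the following conditions. (1) For every $v\in V$, $$D(v)=\sum_{q\in\mathcal{P}_A,\ t(q)=v}c^v_q\,q+\sum_{q\in\mathcal{P}_A,\ h(q)=v}c^v_q\,q .$$ (2) For every $p\in\mathcal{P}\setminus V$, $$D(p)=\sum_{q\in\mathcal{P}_A,\ h(q)=t(p)}c^{t(p)}_q\,qp+\sum_{q\parallel p}c^p_q\,q+\sum_{q\in\mathcal{P}_A,\ t(q)=h(p)}c^{h(p)}_q\,pq,$$ where the coefficients are subject to the following conditions: (a) for every $q\in\mathcal{P}_A$, $c^{h(q)}_q+c^{t(q)}_q=0$; (b) for every path $p=p_1p_2$ with $p_1,p_2\in\mathcal{P}\setminus V$ and every path $q\parallel p$, $$c^{p}_q=c^{p_1p_2}_q=\begin{cases}c^{p_1}_{q_1}+c^{p_2}_{q_2}, & \text{if } p_2\leq_h q \text{ with } q=q_1p_2 \text{ and } p_1\leq_t q\text{ with } q=p_1q_2,\\ c^{p_1}_{q_1}, & \text{if } p_2\leq_h q\text{ with } q=q_1p_2\text{ and } p_1\not\leq_t q,\\ c^{p_2}_{q_2}, & \text{if } p_1\leq_t q\text{ with } q=p_1q_2\text{ and } p_2\not\leq_h q,\\ 0, & \text{if } p_2\not\leq_h q\text{ and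 } p_1\not\leq_t q.\end{cases}$$
   Context: $\mathbf{k}$ is a field. A quiver $\Gamma=(V,E,t,h)$ consists of a set $V$ of vertices, a set $E$ of arrows and maps $t,h:E\to V$ (tail and head); it is finite if $V$ and $E$ are finite. A path of length $\ell\ge 0$ is $p=v_0p_1v_1\cdots p_\ell v_\ell$ with $v_i\in V$, $p_j\in E$, $t(p_j)=v_{j-1}$, $h(p_j)=v_j$; put $t(p)=v_0$, $h(p)=v_\ell$. Vertices are the paths of length $0$. $\mathcal{P}$ is the set of all paths. The path algebra $\mathbf{k}\Gamma$ has $\mathbf{k}$-basis $\mathcal{P}$, with product of paths $p,q$ equal to the concatenation $pq$ if $h(p)=t(q)$ and $0$ otherwise. $p\parallel q$ means $t(p)=t(q)$ and $h(p)=h(q)$. $\mathcal{P}_A=\{p\in\mathcal{P}: h(p)\ne t(p)\}$. For paths $p,q$: $p\leq_t q$ means $q=pr$ for some path $r$, and $p\leq_h q$ means $q=rp$ for some path $r$; such $r$ is unique. A derivation on an algebra $A$ is a $\mathbf{k}$-linear map $D:A\to A$ with $D(xy)=D(x)y+xD(y)$ for all $x,y$. For each $p$, only finitely many $c^p_q$ are nonzero, and empty sums are $0$. *)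

theory Defs
  imports "Graph_Theory.Arc_Walk" "HOL-Library.Poly_Mapping"
begin

text \<open>
  A finite quiver is a \<open>fin_digraph\<close>: loops and parallel arcs are allowed there.
  The path v0 p1 v1 ... pl vl is encoded as the triple (v0, [p1, ..., pl], vl).
  The vertex v, as a path of length 0, is (v, [], v).
\<close>

type_synonym ('v, 'e) path = "'v \<times> 'e list \<times> 'v"

definition ptail :: "('v, 'e) path \<Rightarrow> 'v" where
  "ptail p = fst p"

definition phead :: "('v, 'e) path \<Rightarrow> 'v" where
  "phead p = snd (snd p)"

definition paths :: "('v, 'e) pre_digraph \<Rightarrow> ('v, 'e) path set" where
  "paths G = {(u, es, v). pre_digraph.awalk G u es v}"

definition vertex_path :: "'v \<Rightarrow> ('v, 'e) path" where
  "vertex_path v = (v, [], v)"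

definition vertex_paths :: "('v, 'e) pre_digraph \<Rightarrow> ('v, 'e) path set" where
  "vertex_paths G = vertex_path ` verts G"

definition nonclosed_paths :: "('v, 'e) pre_digraph \<Rightarrow> ('v, 'e) path set" where
  "nonclosed_paths G = {p \<in> paths G. phead p \<noteq> ptail p}"

definition parallel_paths :: "('v, 'e) path \<Rightarrow> ('v, 'e) path \<Rightarrow> bool" where
  "parallel_paths p q \<longleftrightarrow> ptail p = ptail q \<and> phead p = phead q"

text \<open>The concatenation pq, meaningful only if \<open>phead p = ptail q\<close>.\<close>

definition pconcat :: "('v, 'e) path \<Rightarrow> ('v, 'e) path \<Rightarrow> ('v, 'e) path" where
  "pconcat p q = (ptail p, fst (snd p) @ fst (snd q), phead q)"

definition is_concat ::
  "('v, 'e) pre_digraph \<Rightarrow> ('v, 'e) path \<Rightarrow> ('v, 'e) path \<Rightarrow> ('v, 'e) path \<Rightarrow> bool" where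
  "is_concat G q p r \<longleftrightarrow>
     p \<in> paths G \<and> r \<in> paths G \<and> phead p = ptail r \<and> q = pconcat p r"

definition le_tail ::
  "('v, 'e) pre_digraph \<Rightarrow> ('v, 'e) path \<Rightarrow> ('v, 'e) path \<Rightarrow> bool" where
  "le_tail G p q \<longleftrightarrow> (\<exists>r. is_concat G q p r)"

definition le_head ::
  "('v, 'e) pre_digraph \<Rightarrow> ('v, 'e) path \<Rightarrow> ('v, 'e) path \<Rightarrow> bool" where
  "le_head G p q \<longleftrightarrow> (\<exists>r. is_concat G q r p)"

text \<open>
  The path algebra consists of the finitely supported functions on triples whose
  support lies in \<open>paths G\<close>. The triple type also contains triples that are not paths of G,
  so this is a proper carrier set. The basis element p is \<open>Poly_Mapping.single p 1\<close>.
\<close>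

definition path_algebra ::
  "('v, 'e) pre_digraph \<Rightarrow> (('v, 'e) path \<Rightarrow>\<^sub>0 'k::field) set" where
  "path_algebra G = {x. Poly_Mapping.keys x \<subseteq> paths G}"

definition scale :: "'k::field \<Rightarrow> ('a \<Rightarrow>\<^sub>0 'k) \<Rightarrow> ('a \<Rightarrow>\<^sub>0 'k)" where
  "scale a x = Poly_Mapping.map (\<lambda>b. a * b) x"

text \<open>
  The bilinear extension of the product of paths; it differs from the convolution \<open>*\<close> that
  \<open>Poly_Mapping\<close> provides for monoid-indexed mappings.
\<close>

definition path_mult ::
  "(('v, 'e) path \<Rightarrow>\<^sub>0 'k::field) \<Rightarrow> (('v, 'e) path \<Rightarrow>\<^sub>0 'k) \<Rightarrow> (('v, 'e) path \<Rightarrow>\<^sub>0 'k)" where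
  "path_mult x y =
     (\<Sum>p\<in>Poly_Mapping.keys x. \<Sum>q\<in>Poly_Mapping.keys y.
        if phead p = ptail q
        then Poly_Mapping.single (pconcat p q) (Poly_Mapping.lookup x p * Poly_Mapping.lookup y q)
        else 0)"

definition linear_operator_on ::
  "('a \<Rightarrow>\<^sub>0 'k::field) set \<Rightarrow> (('a \<Rightarrow>\<^sub>0 'k) \<Rightarrow> ('a \<Rightarrow>\<^sub>0 'k)) \<Rightarrow> bool" where
  "linear_operator_on A D \<longleftrightarrow>
     (\<forall>x\<in>A. D x \<in> A) \<and>
     (\<forall>x\<in>A. \<forall>y\<in>A. D (x + y) = D x + D y) \<and>
     (\<forall>a. \<forall>x\<in>A. D (scale a x) = scale a (D x))"

definition path_derivation ::
  "('v, 'e) pre_digraph \<Rightarrow> ((('v, 'e) path \<Rightarrow>\<^sub>0 'k::field) \<Rightarrow> (('v, 'e) path \<Rightarrow>\<^sub>0 'k)) \<Rightarrow> bool" where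
  "path_derivation G D \<longleftrightarrow>
     linear_operator_on (path_algebra G) D \<and>
     (\<forall>x\<in>path_algebra G. \<forall>y\<in>path_algebra G.
        D (path_mult x y) = path_mult (D x) y + path_mult x (D y))"

end

theory Submission
  imports Defs
begin

text \<open>
  Both sides are compared coefficientwise. Since multiplication by a path is injective on the
  paths it does not kill, the coefficient of pD(q) or D(p)q at r is a single coefficient of D(q) or
  D(p), or 0. The Leibniz rule on (v, v), on (t(q), h(q)), on (t(p), p) and (p, h(p)), and on
  (p1, p2) gives (1), (a), (2) and (b), respectively. Conversely, (1) and (2) express every c p r
  with r not parallel to p by the coefficients at an end of p; this leaves the Leibniz
  rule for pq with r parallel to pq, which is (b), and for pq = 0, which is (a).
\<close>

text \<open>The core, \<open>leibniz_coeffs_iff\<close>, is a statement about a table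
  \<open>c\<close> of coefficients in an abelian group. Multiplying by a path on either side makes
  sense for any function on paths, and these two actions obey the laws of a bimodule; the
  computations with p, q and r are carried out there. Finite support enters only when elements of
  the algebra are translated into coefficients: a quiver with an oriented cycle has infinitely many
  paths, so the sums in (1) and (2) are taken with \<open>sum'\<close>. In (1) and (2) some
  coefficients stand on both sides at the same basis element. Read at r, (1) is trivial if r is
  nonclosed with an end at v and says that the coefficient is 0 otherwise; (2) is trivial if r is
  parallel to p and prescribes the coefficient otherwise. This is why r is always sorted by the ends
  that it shares with the path under D.\<close>

section \<open>Concatenation of paths and cancellation\<close>

lemma ptail_pconcat [simp]: "ptail (pconcat p q) = ptail p"
  and phead_pconcat [simp]: "phead (pconcat p q) = phead q"
  by (simp_all add: pconcat_def ptail_def phead_def)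

lemma ptail_vertex_path [simp]: "ptail (vertex_path v) = v"
  and phead_vertex_path [simp]: "phead (vertex_path v) = v"
  by (simp_all add: vertex_path_def ptail_def phead_def)

lemma pconcat_assoc: "pconcat (pconcat p q) r = pconcat p (pconcat q r)"
  by (simp add: pconcat_def ptail_def phead_def)

lemma pconcat_vertex_path_left [simp]: "v = ptail p \<Longrightarrow> pconcat (vertex_path v) p = p"
  and pconcat_vertex_path_right [simp]: "v = phead p \<Longrightarrow> pconcat p (vertex_path v) = p"
  by (simp_all add: pconcat_def vertex_path_def ptail_def phead_def)

lemma is_concat_ends:
  assumes "is_concat G r p q"
  shows "ptail r = ptail p" "phead r = phead q" "phead p = ptail q" "p \<in> paths G" "q \<in> paths G"
  using assms by (auto simp: is_concat_def)

lemma is_concat_cancel_right: "is_concat G r s q \<Longrightarrow> is_concat G r s' q \<Longrightarrow> s = s'"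
  by (auto simp: is_concat_def pconcat_def ptail_def phead_def prod_eq_iff)

lemma is_concat_cancel_left: "is_concat G r p s \<Longrightarrow> is_concat G r p s' \<Longrightarrow> s = s'"
  by (auto simp: is_concat_def pconcat_def ptail_def phead_def prod_eq_iff)

section \<open>Coefficients of a product with one path\<close>

text \<open>
  If x is an element of the path algebra with coefficients f, these are the coefficients at r
  of the products xq and px.
\<close>

definition right_mult_coeff ::
  "('v, 'e) pre_digraph \<Rightarrow> (('v, 'e) path \<Rightarrow> 'k::zero) \<Rightarrow> ('v, 'e) path \<Rightarrow> ('v, 'e) path \<Rightarrow> 'k" where
  "right_mult_coeff G f q r = (if le_head G q r then f (THE s. is_concat G r s q) else 0)"

definition left_mult_coeff ::
  "('v, 'e) pre_digraph \<Rightarrow> ('v, 'e) path \<Rightarrow> (('v, 'e) path \<Rightarrow> 'k::zero) \<Rightarrow> ('v, 'e) path \<Rightarrow> 'k" where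
  "left_mult_coeff G p f r = (if le_tail G p r then f (THE s. is_concat G r p s) else 0)"

text \<open>Right cancellation makes the definite description in \<open>right_mult_coeff\<close>
  denote this s.\<close>

lemma right_mult_coeff_concat: "is_concat G r s q \<Longrightarrow> right_mult_coeff G f q r = f s"
  unfolding right_mult_coeff_def le_head_def
  by (metis (no_types, lifting) is_concat_cancel_right the_equality)

lemma left_mult_coeff_concat: "is_concat G r p s \<Longrightarrow> left_mult_coeff G p f r = f s"
  unfolding left_mult_coeff_def le_tail_def
  by (metis (no_types, lifting) is_concat_cancel_left the_equality)

lemma right_mult_coeff_eq_0: "(\<And>s. is_concat G r s q \<Longrightarrow> f s = 0) \<Longrightarrow> right_mult_coeff G f q r = 0"
  by (metis right_mult_coeff_concat right_mult_coeff_def le_head_def)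

lemma left_mult_coeff_eq_0: "(\<And>s. is_concat G r p s \<Longrightarrow> f s = 0) \<Longrightarrow> left_mult_coeff G p f r = 0"
  by (metis left_mult_coeff_concat left_mult_coeff_def le_tail_def)

text \<open>The coefficient function is read only at a factor s of r. Hence what is known about the
  ends of s may be used to rewrite \<open>f s\<close>.\<close>

lemma right_mult_coeff_cong:
  "(\<And>s. is_concat G r s q \<Longrightarrow> f s = g s) \<Longrightarrow> right_mult_coeff G f q r = right_mult_coeff G g q r"
  by (metis right_mult_coeff_concat right_mult_coeff_def le_head_def)

lemma left_mult_coeff_cong:
  "(\<And>s. is_concat G r p s \<Longrightarrow> f s = g s) \<Longrightarrow> left_mult_coeff G p f r = left_mult_coeff G p g r"
  by (metis left_mult_coeff_concat left_mult_coeff_def le_tail_def)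

lemma right_mult_coeff_add:
  "right_mult_coeff G (\<lambda>s. f s + g s) q r = right_mult_coeff G f q r + (right_mult_coeff G g q r :: 'k::monoid_add)"
  by (simp add: right_mult_coeff_def)

lemma left_mult_coeff_add:
  "left_mult_coeff G p (\<lambda>s. f s + g s) r = left_mult_coeff G p f r + (left_mult_coeff G p g r :: 'k::monoid_add)"
  by (simp add: left_mult_coeff_def)

text \<open>A factor s with r = sp runs from the tail of r to the tail of p, so whether s is closed
  is decided by r and p.\<close>

lemma right_mult_coeff_nonclosed:
  "right_mult_coeff G (\<lambda>s. if s \<in> nonclosed_paths G then f s else 0) p r =
    (if ptail r = ptail p then 0 else right_mult_coeff G f p r)"
proof (cases "le_head G p r")
  case True
  then obtain s where s: "is_concat G r s p"
    by (auto simp: le_head_def)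
  then show ?thesis
    using is_concat_ends[OF s] by (auto simp: right_mult_coeff_concat nonclosed_paths_def)
qed (simp add: right_mult_coeff_def)

lemma left_mult_coeff_nonclosed:
  "left_mult_coeff G p (\<lambda>s. if s \<in> nonclosed_paths G then f s else 0) r =
    (if phead r = phead p then 0 else left_mult_coeff G p f r)"
proof (cases "le_tail G p r")
  case True
  then obtain s where s: "is_concat G r p s"
    by (auto simp: le_tail_def)
  then show ?thesis
    using is_concat_ends[OF s] by (auto simp: left_mult_coeff_concat nonclosed_paths_def)
qed (simp add: left_mult_coeff_def)

lemma right_mult_coeff_phead_neq: "phead r \<noteq> phead p \<Longrightarrow> right_mult_coeff G f p r = 0"
  by (auto intro: right_mult_coeff_eq_0 dest: is_concat_ends)

lemma left_mult_coeff_ptail_neq: "ptail r \<noteq> ptail p \<Longrightarrow> left_mult_coeff G p f r = 0"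
  by (auto intro: left_mult_coeff_eq_0 dest: is_concat_ends)

context wf_digraph
begin

lemma paths_pconcat:
  "p \<in> paths G \<Longrightarrow> q \<in> paths G \<Longrightarrow> phead p = ptail q \<Longrightarrow> pconcat p q \<in> paths G"
  by (auto simp: paths_def pconcat_def ptail_def phead_def intro: awalk_appendI simp del: awalk_append_iff)

lemma is_concat_pconcat:
  "p \<in> paths G \<Longrightarrow> q \<in> paths G \<Longrightarrow> phead p = ptail q \<Longrightarrow> is_concat G (pconcat p q) p q"
  by (simp add: is_concat_def)

lemma is_concat_paths: "is_concat G r p q \<Longrightarrow> r \<in> paths G"
  by (auto simp: is_concat_def paths_pconcat)

lemma ptail_in_verts: "p \<in> paths G \<Longrightarrow> ptail p \<in> verts G"
  by (auto simp: paths_def ptail_def dest: awalk_hd_in_verts)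

lemma phead_in_verts: "p \<in> paths G \<Longrightarrow> phead p \<in> verts G"
  by (auto simp: paths_def phead_def dest: awalk_last_in_verts)

lemma vertex_path_in_paths [simp]: "vertex_path v \<in> paths G \<longleftrightarrow> v \<in> verts G"
  by (auto simp: paths_def vertex_path_def awalk_Nil_iff)

lemma is_concat_vertex_path_right:
  "r \<in> paths G \<Longrightarrow> is_concat G r s (vertex_path v) \<longleftrightarrow> s = r \<and> phead r = v"
  by (auto simp: is_concat_def phead_in_verts)

lemma is_concat_vertex_path_left:
  "r \<in> paths G \<Longrightarrow> is_concat G r (vertex_path v) s \<longleftrightarrow> s = r \<and> ptail r = v"
  by (auto simp: is_concat_def ptail_in_verts)

lemma right_mult_coeff_vertex_path:
  assumes "r \<in> paths G"
  shows "right_mult_coeff G f (vertex_path v) r = (if phead r = v then f r else 0)"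
  using assms
  by (auto intro!: right_mult_coeff_concat right_mult_coeff_eq_0 simp: is_concat_vertex_path_right)

lemma left_mult_coeff_vertex_path:
  assumes "r \<in> paths G"
  shows "left_mult_coeff G (vertex_path v) f r = (if ptail r = v then f r else 0)"
  using assms
  by (auto intro!: left_mult_coeff_concat left_mult_coeff_eq_0 simp: is_concat_vertex_path_left)

lemma right_mult_coeff_not_path: "r \<notin> paths G \<Longrightarrow> right_mult_coeff G f q r = 0"
  using is_concat_paths right_mult_coeff_eq_0 by metis

lemma left_mult_coeff_not_path: "r \<notin> paths G \<Longrightarrow> left_mult_coeff G p f r = 0"
  using is_concat_paths left_mult_coeff_eq_0 by metis

text \<open>This is the associativity x(pq) = (xp)q, read at r: splitting off q and then p is the
  same as splitting off pq.\<close>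

lemma right_mult_coeff_pconcat:
  assumes "p \<in> paths G" "q \<in> paths G" "phead p = ptail q"
  shows "right_mult_coeff G f (pconcat p q) r =
    right_mult_coeff G (right_mult_coeff G f p) q r"
proof (cases "le_head G (pconcat p q) r")
  case True
  then obtain s where s: "is_concat G r s (pconcat p q)"
    by (auto simp: le_head_def)
  with assms have 1: "is_concat G (pconcat s p) s p" "is_concat G r (pconcat s p) q"
    by (auto simp: is_concat_def paths_pconcat pconcat_assoc)
  show ?thesis
    using right_mult_coeff_concat[OF s, of f] right_mult_coeff_concat[OF 1(1), of f]
      right_mult_coeff_concat[OF 1(2), of "right_mult_coeff G f p"] by simp
next
  case False
  have "right_mult_coeff G (right_mult_coeff G f p) q r = 0"
  proof (intro right_mult_coeff_eq_0)
    fix s t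
    assume "is_concat G r s q" "is_concat G s t p"
    then have "is_concat G r t (pconcat p q)"
      by (auto simp: is_concat_def paths_pconcat pconcat_assoc)
    with False show "f t = 0"
      unfolding le_head_def by blast
  qed
  with False show ?thesis
    by (simp add: right_mult_coeff_def)
qed

lemma left_mult_coeff_pconcat:
  assumes "p \<in> paths G" "q \<in> paths G" "phead p = ptail q"
  shows "left_mult_coeff G (pconcat p q) f r =
    left_mult_coeff G p (left_mult_coeff G q f) r"
proof (cases "le_tail G (pconcat p q) r")
  case True
  then obtain s where s: "is_concat G r (pconcat p q) s"
    by (auto simp: le_tail_def)
  with assms have 1: "is_concat G (pconcat q s) q s" "is_concat G r p (pconcat q s)"
    by (auto simp: is_concat_def paths_pconcat pconcat_assoc)
  show ?thesis
    using left_mult_coeff_concat[OF s, of f] left_mult_coeff_concat[OF 1(1), of f]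
      left_mult_coeff_concat[OF 1(2), of "left_mult_coeff G q f"] by simp
next
  case False
  have "left_mult_coeff G p (left_mult_coeff G q f) r = 0"
  proof (intro left_mult_coeff_eq_0)
    fix s t
    assume "is_concat G r p s" "is_concat G s q t"
    then have "is_concat G r (pconcat p q) t"
      by (auto simp: is_concat_def paths_pconcat pconcat_assoc)
    with False show "f t = 0"
      unfolding le_tail_def by blast
  qed
  with False show ?thesis
    by (simp add: left_mult_coeff_def)
qed

text \<open>This is p(xq) = (px)q, read at r: both sides take the coefficient at the s with r = psq,
  and 0 if there is none.\<close>

lemma left_right_mult_coeff_commute:
  "left_mult_coeff G p (right_mult_coeff G f q) r = right_mult_coeff G (left_mult_coeff G p f) q r"
proof (cases "\<exists>s. p \<in> paths G \<and> q \<in> paths G \<and> s \<in> paths G \<and> phead p = ptail s \<and> phead s = ptail q \<and>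
    r = pconcat p (pconcat s q)")
  case True
  then obtain s where s: "is_concat G r p (pconcat s q)" "is_concat G (pconcat s q) s q"
      "is_concat G r (pconcat p s) q" "is_concat G (pconcat p s) p s"
    by (auto simp: is_concat_def paths_pconcat pconcat_assoc)
  show ?thesis
    by (simp add: left_mult_coeff_concat[OF s(1)] right_mult_coeff_concat[OF s(2)]
      right_mult_coeff_concat[OF s(3)] left_mult_coeff_concat[OF s(4)])
next
  case False
  have "left_mult_coeff G p (right_mult_coeff G f q) r = 0"
  proof (intro left_mult_coeff_eq_0 right_mult_coeff_eq_0)
    fix s t assume "is_concat G r p s" "is_concat G s t q"
    then have "p \<in> paths G \<and> q \<in> paths G \<and> t \<in> paths G \<and> phead p = ptail t \<and> phead t = ptail q \<and>
      r = pconcat p (pconcat t q)"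
      by (simp add: is_concat_def)
    with False show "f t = 0" by blast
  qed
  moreover have "right_mult_coeff G (left_mult_coeff G p f) q r = 0"
  proof (intro left_mult_coeff_eq_0 right_mult_coeff_eq_0)
    fix s t assume "is_concat G r s q" "is_concat G s p t"
    then have "p \<in> paths G \<and> q \<in> paths G \<and> t \<in> paths G \<and> phead p = ptail t \<and> phead t = ptail q \<and>
      r = pconcat p (pconcat t q)"
      by (simp add: is_concat_def pconcat_assoc)
    with False show "f t = 0" by blast
  qed
  ultimately show ?thesis by simp
qed

end

section \<open>The Leibniz rule in coefficients\<close>

text \<open>The value 0 is the coefficient of D(0), for paths p and q that do not meet. Only paths r
  are tested because \<open>c p\<close> is arbitrary on the other triples of the type.\<close>

definition leibniz_coeffs ::
  "('v, 'e) pre_digraph \<Rightarrow> (('v, 'e) path \<Rightarrow> ('v, 'e) path \<Rightarrow> 'k::monoid_add) \<Rightarrow> bool" where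
  "leibniz_coeffs G c \<longleftrightarrow> (\<forall>p\<in>paths G. \<forall>q\<in>paths G. \<forall>r\<in>paths G.
    (if phead p = ptail q then c (pconcat p q) r else 0) =
      right_mult_coeff G (c p) q r + left_mult_coeff G p (c q) r)"

text \<open>The default value 0 of the two coefficient functions absorbs the negated conditions, so
  the four cases of (b) become one sum of two terms. As q1 and q2 are unique, quantifying over them
  amounts to evaluating at them.\<close>

lemma concat_coeff_cases_iff:
  fixes c :: "('v, 'e) path \<Rightarrow> ('v, 'e) path \<Rightarrow> 'k::monoid_add"
  shows "(\<forall>q1 q2. is_concat G q q1 p2 \<and> is_concat G q p1 q2 \<longrightarrow> c p q = c p1 q1 + c p2 q2) \<and>
    (\<forall>q1. is_concat G q q1 p2 \<and> \<not> le_tail G p1 q \<longrightarrow> c p q = c p1 q1) \<and>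
    (\<forall>q2. is_concat G q p1 q2 \<and> \<not> le_head G p2 q \<longrightarrow> c p q = c p2 q2) \<and>
    (\<not> le_head G p2 q \<and> \<not> le_tail G p1 q \<longrightarrow> c p q = 0) \<longleftrightarrow>
    c p q = right_mult_coeff G (c p1) p2 q + left_mult_coeff G p1 (c p2) q"
  (is "?L \<longleftrightarrow> ?R")
proof -
  have R: "right_mult_coeff G (c p1) p2 q = 0" if "\<not> le_head G p2 q"
    using that by (simp add: right_mult_coeff_def)
  have L: "left_mult_coeff G p1 (c p2) q = 0" if "\<not> le_tail G p1 q"
    using that by (simp add: left_mult_coeff_def)
  note R' = right_mult_coeff_concat[of G q _ p2 "c p1"] and L' = left_mult_coeff_concat[of G q p1 _ "c p2"]
  show ?thesis
  proof
    assume ?L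
    consider q1 q2 where "is_concat G q q1 p2" "is_concat G q p1 q2"
      | q1 where "is_concat G q q1 p2" "\<not> le_tail G p1 q"
      | q2 where "is_concat G q p1 q2" "\<not> le_head G p2 q"
      | "\<not> le_head G p2 q" "\<not> le_tail G p1 q"
      unfolding le_head_def le_tail_def by blast
    then show ?R
    proof cases
      case (1 q1 q2)
      with \<open>?L\<close> have "c p q = c p1 q1 + c p2 q2" by blast
      with 1 show ?thesis by (simp only: R' L')
    next
      case (2 q1)
      with \<open>?L\<close> have "c p q = c p1 q1" by blast
      with 2 show ?thesis by (simp add: R' L)
    next
      case (3 q2)
      with \<open>?L\<close> have "c p q = c p2 q2" by blast
      with 3 show ?thesis by (simp add: L' R)
    next
      case 4
      with \<open>?L\<close> have "c p q = 0" by blast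
      with 4 show ?thesis by (simp add: L R)
    qed
  next
    assume eq: ?R
    show ?L
    proof (intro conjI allI impI; (elim conjE)?)
      fix q1 q2 assume "is_concat G q q1 p2" "is_concat G q p1 q2"
      with eq show "c p q = c p1 q1 + c p2 q2" by (simp add: R' L')
    next
      fix q1 assume "is_concat G q q1 p2" "\<not> le_tail G p1 q"
      with eq show "c p q = c p1 q1" by (simp add: R' L)
    next
      fix q2 assume "is_concat G q p1 q2" "\<not> le_head G p2 q"
      with eq show "c p q = c p2 q2" by (simp add: L' R)
    next
      assume "\<not> le_head G p2 q" "\<not> le_tail G p1 q"
      with eq show "c p q = 0" by (simp add: L R)
    qed
  qed
qed

lemma (in wf_digraph) leibniz_coeffs_iff:
  fixes c :: "('a, 'b) path \<Rightarrow> ('a, 'b) path \<Rightarrow> 'k::ab_group_add"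
  shows "leibniz_coeffs G c \<longleftrightarrow>
    (\<forall>v\<in>verts G. \<forall>r\<in>paths G. c (vertex_path v) r =
      (if r \<in> nonclosed_paths G \<and> ptail r = v then c (vertex_path v) r else 0) +
      (if r \<in> nonclosed_paths G \<and> phead r = v then c (vertex_path v) r else 0)) \<and>
    (\<forall>p\<in>paths G - vertex_paths G. \<forall>r\<in>paths G. c p r =
      right_mult_coeff G (\<lambda>s. if s \<in> nonclosed_paths G then c (vertex_path (ptail p)) s else 0) p r +
      (if parallel_paths r p then c p r else 0) +
      left_mult_coeff G p (\<lambda>s. if s \<in> nonclosed_paths G then c (vertex_path (phead p)) s else 0) r) \<and>
    (\<forall>q\<in>nonclosed_paths G. c (vertex_path (phead q)) q + c (vertex_path (ptail q)) q = 0) \<and>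
    (\<forall>p1\<in>paths G - vertex_paths G. \<forall>p2\<in>paths G - vertex_paths G. \<forall>p q.
      is_concat G p p1 p2 \<and> q \<in> paths G \<and> parallel_paths q p \<longrightarrow>
      c p q = right_mult_coeff G (c p1) p2 q + left_mult_coeff G p1 (c p2) q)"
    (is "_ \<longleftrightarrow> ?vertex \<and> ?nonvertex \<and> ?a \<and> ?b")
proof
  assume "leibniz_coeffs G c"
  then have leib: "(if phead p = ptail q then c (pconcat p q) r else 0) =
      right_mult_coeff G (c p) q r + left_mult_coeff G p (c q) r"
    if "p \<in> paths G" "q \<in> paths G" "r \<in> paths G" for p q r
    using that by (auto simp only: leibniz_coeffs_def)
  have vert: "c (vertex_path v) r =
      (if phead r = v then c (vertex_path v) r else 0) + (if ptail r = v then c (vertex_path v) r else 0)"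
    if "v \<in> verts G" "r \<in> paths G" for v r
    using leib[of "vertex_path v" "vertex_path v" r] that
    by (simp add: right_mult_coeff_vertex_path left_mult_coeff_vertex_path)
  have tail: "c p r = right_mult_coeff G (c (vertex_path (ptail p))) p r + (if ptail r = ptail p then c p r else 0)"
    and head: "c p r = (if phead r = phead p then c p r else 0) + left_mult_coeff G p (c (vertex_path (phead p))) r"
    if "p \<in> paths G" "r \<in> paths G" for p r
    using leib[of "vertex_path (ptail p)" p r] leib[of p "vertex_path (phead p)" r] that
    by (simp_all add: right_mult_coeff_vertex_path left_mult_coeff_vertex_path ptail_in_verts phead_in_verts)
  \<comment> \<open>For a closed r at v, \<open>vert\<close> reads x = x + x, so x = 0 in every
    characteristic.\<close>
  have ?vertex
  proof (intro ballI)
    fix v r assume "v \<in> verts G" "r \<in> paths G"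
    then show "c (vertex_path v) r =
      (if r \<in> nonclosed_paths G \<and> ptail r = v then c (vertex_path v) r else 0) +
      (if r \<in> nonclosed_paths G \<and> phead r = v then c (vertex_path v) r else 0)"
      using vert[of v r] by (simp add: nonclosed_paths_def split: if_splits)
  qed
  moreover have ?nonvertex
  proof (intro ballI)
    fix p r assume p: "p \<in> paths G - vertex_paths G" and r: "r \<in> paths G"
    show "c p r =
      right_mult_coeff G (\<lambda>s. if s \<in> nonclosed_paths G then c (vertex_path (ptail p)) s else 0) p r +
      (if parallel_paths r p then c p r else 0) +
      left_mult_coeff G p (\<lambda>s. if s \<in> nonclosed_paths G then c (vertex_path (phead p)) s else 0) r"
      \<comment> \<open>If r shares only its head with p, then \<open>tail\<close> yields the first
        term and the others vanish; if it shares only its tail, \<open>head\<close> yields the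
        third. If it shares both ends, only the middle term is left. If it shares neither,
        \<open>tail\<close> already gives 0 because every path sp ends at the head of p.\<close>
      using tail[of p r] head[of p r] p r
      by (auto simp: right_mult_coeff_nonclosed left_mult_coeff_nonclosed parallel_paths_def
        right_mult_coeff_phead_neq left_mult_coeff_ptail_neq)
  qed
  moreover have ?a
  proof
    fix q assume "q \<in> nonclosed_paths G"
    then show "c (vertex_path (phead q)) q + c (vertex_path (ptail q)) q = 0"
      using leib[of "vertex_path (ptail q)" "vertex_path (phead q)" q]
      by (simp add: nonclosed_paths_def right_mult_coeff_vertex_path left_mult_coeff_vertex_path
        ptail_in_verts phead_in_verts add.commute split: if_splits)
  qed
  moreover have ?b
  proof (intro ballI allI impI, elim conjE)
    fix p1 p2 p q
    assume "is_concat G p p1 p2" "q \<in> paths G"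
    then show "c p q = right_mult_coeff G (c p1) p2 q + left_mult_coeff G p1 (c p2) q"
      using leib[of p1 p2 q] by (simp add: is_concat_def)
  qed
  ultimately show "?vertex \<and> ?nonvertex \<and> ?a \<and> ?b" by blast
next
  assume "?vertex \<and> ?nonvertex \<and> ?a \<and> ?b"
  then have vertex: ?vertex and nonvertex: ?nonvertex and a: ?a and b: ?b
    by blast+
  have closed: "c (vertex_path v) r = 0" if "v \<in> verts G" "r \<in> paths G" "ptail r = phead r" for v r
    using vertex[rule_format, of v r] that by (simp add: nonclosed_paths_def)
  \<comment> \<open>Away from the head of p only the third sum of (2) survives, since the first two
    consist of paths ending there. For a vertex p, (1) says the same.\<close>
  have head: "c p r = left_mult_coeff G p (c (vertex_path (phead p))) r"
    if "p \<in> paths G" "r \<in> paths G" "phead r \<noteq> phead p" for p r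
  proof (cases "p \<in> vertex_paths G")
    case True
    then obtain v where "v \<in> verts G" "p = vertex_path v"
      by (auto simp: vertex_paths_def)
    with that vertex[rule_format, of v r] show ?thesis
      by (auto simp: left_mult_coeff_vertex_path)
  next
    case False
    with that nonvertex[rule_format, of p r] show ?thesis
      by (auto simp: left_mult_coeff_nonclosed parallel_paths_def right_mult_coeff_phead_neq)
  qed
  have tail: "c p r = right_mult_coeff G (c (vertex_path (ptail p))) p r"
    if "p \<in> paths G" "r \<in> paths G" "ptail r \<noteq> ptail p" for p r
  proof (cases "p \<in> vertex_paths G")
    case True
    then obtain v where "v \<in> verts G" "p = vertex_path v"
      by (auto simp: vertex_paths_def)
    with that vertex[rule_format, of v r] show ?thesis
      by (auto simp: right_mult_coeff_vertex_path)
  next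
    case False
    with that nonvertex[rule_format, of p r] show ?thesis
      by (auto simp: right_mult_coeff_nonclosed parallel_paths_def left_mult_coeff_ptail_neq)
  qed
  show "leibniz_coeffs G c"
    unfolding leibniz_coeffs_def
  proof (intro ballI)
    fix p q r assume pqr: "p \<in> paths G" "q \<in> paths G" "r \<in> paths G"
    consider (incomposable) "phead p \<noteq> ptail q"
      | (left_vertex) v where "phead p = ptail q" "v \<in> verts G" "p = vertex_path v"
      | (right_vertex) v where "phead p = ptail q" "v \<in> verts G" "q = vertex_path v"
      | (nonvertex) "phead p = ptail q" "p \<notin> vertex_paths G" "q \<notin> vertex_paths G"
      unfolding vertex_paths_def by blast
    then show "(if phead p = ptail q then c (pconcat p q) r else 0) =
      right_mult_coeff G (c p) q r + left_mult_coeff G p (c q) r"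
    proof cases
      case incomposable
      \<comment> \<open>If r = sq, then s ends at the tail of q and not at the head of p, so
        \<open>head\<close> replaces D(p) by pD(h(p)); dually, \<open>tail\<close> replaces D(q) by
        D(t(q))q. The right-hand side becomes p(D(h(p)) + D(t(q)))q. Only paths from h(p) to t(q)
        contribute to it, and for these (a) makes the two coefficients cancel.\<close>
      have "right_mult_coeff G (c p) q r =
          right_mult_coeff G (left_mult_coeff G p (c (vertex_path (phead p)))) q r"
        using incomposable pqr by (intro right_mult_coeff_cong head) (simp_all add: is_concat_def)
      moreover have "left_mult_coeff G p (c q) r =
          right_mult_coeff G (left_mult_coeff G p (c (vertex_path (ptail q)))) q r"
        unfolding left_right_mult_coeff_commute[symmetric]
        using incomposable pqr by (intro left_mult_coeff_cong tail) (simp_all add: is_concat_def)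
      moreover have "right_mult_coeff G (\<lambda>s. left_mult_coeff G p (c (vertex_path (phead p))) s +
          left_mult_coeff G p (c (vertex_path (ptail q))) s) q r = 0"
        unfolding left_mult_coeff_add[symmetric]
      proof (intro right_mult_coeff_eq_0 left_mult_coeff_eq_0)
        fix s t assume "is_concat G r s q" "is_concat G s p t"
        then have "t \<in> paths G" "ptail t = phead p" "phead t = ptail q"
          by (auto simp: is_concat_def)
        with a[rule_format, of t] incomposable
        show "c (vertex_path (phead p)) t + c (vertex_path (ptail q)) t = 0"
          by (simp add: nonclosed_paths_def add.commute)
      qed
      ultimately show ?thesis
        using incomposable by (simp add: right_mult_coeff_add)
    next
      case left_vertex
      show ?thesis
      proof (cases "ptail r = v")
        case True
        \<comment> \<open>A factor s with r = sq starts at v and ends at the tail of q, which is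
          again v; D(v) has no closed terms.\<close>
        then have "right_mult_coeff G (c p) q r = 0"
          using left_vertex by (intro right_mult_coeff_eq_0) (simp add: is_concat_def closed)
        with True left_vertex pqr show ?thesis
          by (simp add: left_mult_coeff_vertex_path)
      next
        case False
        with tail[of q r] left_vertex pqr show ?thesis
          by (simp add: left_mult_coeff_vertex_path)
      qed
    next
      case right_vertex
      show ?thesis
      proof (cases "phead r = v")
        case True
        then have "left_mult_coeff G p (c q) r = 0"
          using right_vertex by (intro left_mult_coeff_eq_0) (simp add: is_concat_def closed)
        with True right_vertex pqr show ?thesis
          by (simp add: right_mult_coeff_vertex_path)
      next
        case False
        with head[of p r] right_vertex pqr show ?thesis
          by (simp add: right_mult_coeff_vertex_path)
      qed
    next
      case nonvertex
      have pq: "pconcat p q \<in> paths G"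
        using nonvertex pqr by (simp add: paths_pconcat)
      consider "parallel_paths r (pconcat p q)" | "ptail r \<noteq> ptail p" | "phead r \<noteq> phead q"
        by (auto simp: parallel_paths_def)
      then show ?thesis
      proof cases
        case 1
        with b[rule_format, of p q "pconcat p q" r] nonvertex pqr show ?thesis
          by (simp add: is_concat_pconcat)
      next
        case 2
        \<comment> \<open>Here pD(q) has no term at r, and \<open>tail\<close> applies to both pq
          and p. What remains is D(t(p))(pq) = (D(t(p))p)q.\<close>
        have "right_mult_coeff G (c p) q r =
            right_mult_coeff G (right_mult_coeff G (c (vertex_path (ptail p))) p) q r"
          using 2 pqr by (intro right_mult_coeff_cong tail) (simp_all add: is_concat_def)
        with 2 tail[OF pq, of r] nonvertex pqr show ?thesis
          by (simp add: left_mult_coeff_ptail_neq right_mult_coeff_pconcat)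
      next
        case 3
        have "left_mult_coeff G p (c q) r =
            left_mult_coeff G p (left_mult_coeff G q (c (vertex_path (phead q)))) r"
          using 3 pqr by (intro left_mult_coeff_cong head) (simp_all add: is_concat_def)
        with 3 head[OF pq, of r] nonvertex pqr show ?thesis
          by (simp add: right_mult_coeff_phead_neq left_mult_coeff_pconcat)
      qed
    qed
  qed
qed

section \<open>The path algebra, its product and the reduction to basis elements\<close>

lemma lookup_scale [simp]: "Poly_Mapping.lookup (scale a x) k = a * Poly_Mapping.lookup x k"
  by (simp add: scale_def Poly_Mapping.map.rep_eq when_def)

lemma scale_0_left [simp]: "scale 0 x = 0"
  and scale_0_right [simp]: "scale a 0 = 0"
  and scale_add_right: "scale a (x + y) = scale a x + scale a y"
  and scale_sum_right: "scale a (sum f A) = (\<Sum>i\<in>A. scale a (f i))"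
  and scale_single: "scale a (Poly_Mapping.single k b) = Poly_Mapping.single k (a * b)"
  by (rule poly_mapping_eqI;
    simp add: lookup_add lookup_sum lookup_single when_def algebra_simps sum_distrib_left)+

lemma path_algebra_0 [simp]: "0 \<in> path_algebra G"
  by (simp add: path_algebra_def)

lemma path_algebra_add [simp]:
  "x \<in> path_algebra G \<Longrightarrow> y \<in> path_algebra G \<Longrightarrow> x + y \<in> path_algebra G"
  using keys_add[of x y] by (auto simp: path_algebra_def)

lemma path_algebra_scale [simp]: "x \<in> path_algebra G \<Longrightarrow> scale a x \<in> path_algebra G"
  by (auto simp: path_algebra_def in_keys_iff subset_iff simp del: split_paired_All)

lemma path_algebra_single [simp]: "p \<in> paths G \<Longrightarrow> Poly_Mapping.single p a \<in> path_algebra G"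
  by (simp add: path_algebra_def)

lemma path_algebra_sum [simp]:
  "(\<And>i. i \<in> I \<Longrightarrow> f i \<in> path_algebra G) \<Longrightarrow> sum f I \<in> path_algebra G"
  by (induction I rule: infinite_finite_induct) auto

text \<open>An element is the sum over its support of its scaled basis elements, and all partial
  sums stay in the carrier. Membership is kept in the premises because D is linear only
  there.\<close>

lemma path_algebra_induct [consumes 1, case_names zero basis scale add]:
  assumes x: "x \<in> path_algebra G"
    and zero: "P 0"
    and basis: "\<And>p. p \<in> paths G \<Longrightarrow> P (Poly_Mapping.single p 1)"
    and scale: "\<And>a x. x \<in> path_algebra G \<Longrightarrow> P x \<Longrightarrow> P (scale a x)"
    and add: "\<And>x y. x \<in> path_algebra G \<Longrightarrow> y \<in> path_algebra G \<Longrightarrow> P x \<Longrightarrow> P y \<Longrightarrow> P (x + y)"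
  shows "P x"
proof -
  let ?m = "\<lambda>p. scale (Poly_Mapping.lookup x p) (Poly_Mapping.single p 1)"
  have "P (\<Sum>p\<in>S. ?m p)" if "finite S" "S \<subseteq> paths G" for S
    using that
  proof (induction S rule: finite_induct)
    case (insert p S)
    then show ?case
      by (auto intro!: add scale basis path_algebra_sum path_algebra_scale path_algebra_single)
  qed (simp add: zero)
  moreover have "(\<Sum>p\<in>Poly_Mapping.keys x. ?m p) = x"
    by (rule poly_mapping_eqI) (simp add: scale_single lookup_sum lookup_single when_def in_keys_iff)
  ultimately show ?thesis
    using x by (metis (no_types, lifting) finite_keys mem_Collect_eq path_algebra_def)
qed

abbreviation mult_summand where
  "mult_summand x y p q \<equiv>
    (if phead p = ptail q
     then Poly_Mapping.single (pconcat p q) (Poly_Mapping.lookup x p * Poly_Mapping.lookup y q) else 0)"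

text \<open>The index sets in \<open>path_mult\<close> are supports, which may shrink under addition
  and scaling. Terms outside them are 0, so products can be compared over common index sets.\<close>

lemma path_mult_superset:
  assumes "finite S" "finite T" "Poly_Mapping.keys x \<subseteq> S" "Poly_Mapping.keys y \<subseteq> T"
  shows "path_mult x y = (\<Sum>p\<in>S. \<Sum>q\<in>T. mult_summand x y p q)"
proof -
  have "path_mult x y = (\<Sum>p\<in>Poly_Mapping.keys x. \<Sum>q\<in>T. mult_summand x y p q)"
    unfolding path_mult_def using assms
    by (intro sum.cong sum.mono_neutral_left) (auto simp: in_keys_iff)
  also have "\<dots> = (\<Sum>p\<in>S. \<Sum>q\<in>T. mult_summand x y p q)"
    using assms by (intro sum.mono_neutral_left) (auto simp: in_keys_iff intro!: sum.neutral)
  finally show ?thesis .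
qed

lemma path_mult_0_left [simp]: "path_mult 0 y = 0"
  and path_mult_0_right [simp]: "path_mult x 0 = 0"
  by (simp_all add: path_mult_def)

lemma path_mult_add_left: "path_mult (x + y) z = path_mult x z + path_mult y z"
proof -
  let ?S = "Poly_Mapping.keys x \<union> Poly_Mapping.keys y"
  show ?thesis
    using keys_add[of x y]
    by (simp add: path_mult_superset[of ?S "Poly_Mapping.keys z"] sum.distrib[symmetric]
      lookup_add distrib_right single_add if_distrib cong: if_cong)
qed

lemma path_mult_add_right: "path_mult z (x + y) = path_mult z x + path_mult z y"
proof -
  let ?S = "Poly_Mapping.keys x \<union> Poly_Mapping.keys y"
  show ?thesis
    using keys_add[of x y]
    by (simp add: path_mult_superset[of "Poly_Mapping.keys z" ?S] sum.distrib[symmetric]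
      lookup_add distrib_left single_add if_distrib cong: if_cong)
qed

lemma path_mult_scale_left: "path_mult (scale a x) y = scale a (path_mult x y)"
proof -
  have "path_mult (scale a x) y =
      (\<Sum>p\<in>Poly_Mapping.keys x. \<Sum>q\<in>Poly_Mapping.keys y. mult_summand (scale a x) y p q)"
    by (rule path_mult_superset) (auto simp: in_keys_iff)
  then show ?thesis
    by (simp add: path_mult_def scale_sum_right scale_single mult.assoc if_distrib[of "scale a"] cong: if_cong)
qed

lemma path_mult_scale_right: "path_mult x (scale a y) = scale a (path_mult x y)"
proof -
  have "path_mult x (scale a y) =
      (\<Sum>p\<in>Poly_Mapping.keys x. \<Sum>q\<in>Poly_Mapping.keys y. mult_summand x (scale a y) p q)"
    by (rule path_mult_superset) (auto simp: in_keys_iff)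
  then show ?thesis
    by (simp add: path_mult_def scale_sum_right scale_single mult.left_commute if_distrib[of "scale a"]
      cong: if_cong)
qed

lemma path_mult_single:
  "path_mult (Poly_Mapping.single p 1) (Poly_Mapping.single q 1) =
    (if phead p = ptail q then Poly_Mapping.single (pconcat p q) 1 else 0)"
  by (simp add: path_mult_def)

text \<open>By cancellation at most one p satisfies r = pq, so the double sum collapses to one
  coefficient of x.\<close>

lemma lookup_path_mult_single_right:
  fixes x :: "('v, 'e) path \<Rightarrow>\<^sub>0 'k::field"
  assumes x: "x \<in> path_algebra G" and q: "q \<in> paths G"
  shows "Poly_Mapping.lookup (path_mult x (Poly_Mapping.single q 1)) r =
    right_mult_coeff G (Poly_Mapping.lookup x) q r"
proof -
  have *: "Poly_Mapping.lookup (path_mult x (Poly_Mapping.single q 1)) r =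
      (\<Sum>p\<in>Poly_Mapping.keys x. if is_concat G r p q then Poly_Mapping.lookup x p else 0)"
  proof -
    have "Poly_Mapping.lookup (\<Sum>t\<in>{q}. mult_summand x (Poly_Mapping.single q 1) p t) r =
        (if is_concat G r p q then Poly_Mapping.lookup x p else 0)" if "p \<in> Poly_Mapping.keys x" for p
      using assms that by (auto simp: lookup_single when_def is_concat_def path_algebra_def)
    moreover have keys: "Poly_Mapping.keys (Poly_Mapping.single q (1::'k)) = {q}"
      by simp
    ultimately show ?thesis
      unfolding path_mult_def lookup_sum[of _ "Poly_Mapping.keys x"] keys by (intro sum.cong refl)
  qed
  show ?thesis
  proof (cases "le_head G q r")
    case True
    then obtain s where s: "is_concat G r s q" by (auto simp: le_head_def)
    have "is_concat G r p q \<longleftrightarrow> p = s" for p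
      using s is_concat_cancel_right by metis
    \<comment> \<open>The factor s may lie outside the support of x; then the sum is empty of
      nonzero terms and the coefficient at s is 0 as well.\<close>
    then show ?thesis
      by (simp add: * right_mult_coeff_concat[OF s] in_keys_iff)
  next
    case False
    then have "\<not> is_concat G r p q" for p
      unfolding le_head_def by blast
    with False show ?thesis
      by (simp add: * right_mult_coeff_def)
  qed
qed

lemma lookup_path_mult_single_left:
  fixes x :: "('v, 'e) path \<Rightarrow>\<^sub>0 'k::field"
  assumes x: "x \<in> path_algebra G" and p: "p \<in> paths G"
  shows "Poly_Mapping.lookup (path_mult (Poly_Mapping.single p 1) x) r =
    left_mult_coeff G p (Poly_Mapping.lookup x) r"
proof -
  have *: "Poly_Mapping.lookup (path_mult (Poly_Mapping.single p 1) x) r =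
      (\<Sum>q\<in>Poly_Mapping.keys x. if is_concat G r p q then Poly_Mapping.lookup x q else 0)"
  proof -
    have "Poly_Mapping.lookup (mult_summand (Poly_Mapping.single p 1) x p q) r =
        (if is_concat G r p q then Poly_Mapping.lookup x q else 0)" if "q \<in> Poly_Mapping.keys x" for q
      using assms that by (auto simp: lookup_single when_def is_concat_def path_algebra_def)
    moreover have keys: "Poly_Mapping.keys (Poly_Mapping.single p (1::'k)) = {p}"
      by simp
    have "path_mult (Poly_Mapping.single p 1) x =
        (\<Sum>q\<in>Poly_Mapping.keys x. mult_summand (Poly_Mapping.single p 1) x p q)"
      unfolding path_mult_def keys by (subst sum.insert) simp_all
    ultimately show ?thesis
      by (simp only: lookup_sum) (intro sum.cong; simp)
  qed
  show ?thesis
  proof (cases "le_tail G p r")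
    case True
    then obtain s where s: "is_concat G r p s" by (auto simp: le_tail_def)
    have "is_concat G r p q \<longleftrightarrow> q = s" for q
      using s is_concat_cancel_left by metis
    then show ?thesis
      by (simp add: * left_mult_coeff_concat[OF s] in_keys_iff)
  next
    case False
    then have "\<not> is_concat G r p q" for q
      unfolding le_tail_def by blast
    with False show ?thesis
      by (simp add: * left_mult_coeff_def)
  qed
qed

lemma (in wf_digraph) path_algebra_mult:
  "x \<in> path_algebra G \<Longrightarrow> y \<in> path_algebra G \<Longrightarrow> path_mult x y \<in> path_algebra G"
  unfolding path_mult_def
  by (intro path_algebra_sum) (auto simp: path_algebra_def paths_pconcat subset_iff simp del: split_paired_All)

text \<open>Both sides of the Leibniz rule are bilinear on the carrier: induction on x, and for a
  basis element x, induction on y.\<close>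

lemma (in wf_digraph) path_derivation_iff_basis:
  assumes D: "linear_operator_on (path_algebra G) D"
  shows "path_derivation G D \<longleftrightarrow>
    (\<forall>p\<in>paths G. \<forall>q\<in>paths G.
      D (path_mult (Poly_Mapping.single p 1) (Poly_Mapping.single q 1)) =
      path_mult (D (Poly_Mapping.single p 1)) (Poly_Mapping.single q 1) +
      path_mult (Poly_Mapping.single p 1) (D (Poly_Mapping.single q 1)))"
    (is "_ \<longleftrightarrow> ?R")
proof
  assume "path_derivation G D"
  then show ?R by (simp add: path_derivation_def)
next
  assume R: ?R
  have add: "D (x + y) = D x + D y" if "x \<in> path_algebra G" "y \<in> path_algebra G" for x y
    using D that by (auto simp: linear_operator_on_def)
  have scale: "D (scale a x) = scale a (D x)" if "x \<in> path_algebra G" for a x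
    using D that by (auto simp: linear_operator_on_def)
  have zero: "D 0 = 0"
    using scale[of 0 0] by simp
  note bilinear = path_mult_add_left path_mult_add_right path_mult_scale_left path_mult_scale_right
  have "D (path_mult x y) = path_mult (D x) y + path_mult x (D y)"
    if "x \<in> path_algebra G" "y \<in> path_algebra G" for x y
    using that
  proof (induction x rule: path_algebra_induct)
    case (basis p)
    from basis(2) show ?case
    proof (induction y rule: path_algebra_induct)
      case (basis q)
      with \<open>p \<in> paths G\<close> R show ?case by blast
    qed (use \<open>p \<in> paths G\<close> in
      \<open>simp_all add: zero add scale bilinear scale_add_right path_algebra_mult algebra_simps\<close>)
  qed (simp_all add: zero add scale bilinear scale_add_right path_algebra_mult algebra_simps)
  with D show "path_derivation G D"
    by (simp add: path_derivation_def)
qed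

section \<open>Coefficients of the sums in (1) and (2)\<close>

text \<open>For infinite support \<open>sum'\<close> would take its default value 0, hence
  \<open>fin\<close>. Injectivity of g keeps two terms from landing on the same basis
  element.\<close>

lemma lookup_sum'_single_inj:
  fixes f :: "'a \<Rightarrow> 'c::comm_monoid_add" and g :: "'a \<Rightarrow> 'b"
  assumes fin: "finite {q \<in> A. f q \<noteq> 0}" and inj: "inj_on g A"
  shows "q \<in> A \<Longrightarrow> Poly_Mapping.lookup (sum' (\<lambda>q. Poly_Mapping.single (g q) (f q)) A) (g q) = f q"
    and "r \<notin> g ` A \<Longrightarrow> Poly_Mapping.lookup (sum' (\<lambda>q. Poly_Mapping.single (g q) (f q)) A) r = 0"
proof -
  let ?B = "{q \<in> A. f q \<noteq> 0}"
  have nz: "Poly_Mapping.single k a \<noteq> 0 \<longleftrightarrow> a \<noteq> 0" for k :: 'b and a :: 'c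
    by (metis lookup_single_eq lookup_zero single_zero)
  have *: "Poly_Mapping.lookup (sum' (\<lambda>q. Poly_Mapping.single (g q) (f q)) A) r =
      (\<Sum>q\<in>?B. if g q = r then f q else 0)" for r
    using fin by (simp add: sum.G_def nz lookup_sum lookup_single when_def)
  show "Poly_Mapping.lookup (sum' (\<lambda>q. Poly_Mapping.single (g q) (f q)) A) (g q) = f q" if "q \<in> A"
  proof -
    have "(\<Sum>s\<in>?B. if g s = g q then f s else 0) = (\<Sum>s\<in>?B. if s = q then f s else 0)"
      using inj that by (intro sum.cong) (auto simp: inj_on_eq_iff)
    also have "\<dots> = f q"
      using fin that by simp
    finally show ?thesis by (simp add: *)
  qed
  show "Poly_Mapping.lookup (sum' (\<lambda>q. Poly_Mapping.single (g q) (f q)) A) r = 0" if "r \<notin> g ` A"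
    unfolding * using that by (intro sum.neutral) auto
qed

lemma lookup_sum'_single:
  assumes "finite {q \<in> A. f q \<noteq> 0}"
  shows "Poly_Mapping.lookup (sum' (\<lambda>q. Poly_Mapping.single q (f q)) A) r = (if r \<in> A then f r else 0)"
  using lookup_sum'_single_inj[of A f "\<lambda>q. q"] assms by auto

text \<open>The first sum in (2) is thus the product of the nonclosed part of f with p; right
  cancellation makes its terms distinct.\<close>

lemma lookup_sum'_single_pconcat_right:
  assumes p: "p \<in> paths G" and fin: "finite {q \<in> paths G. f q \<noteq> 0}"
  shows "Poly_Mapping.lookup (sum' (\<lambda>q. Poly_Mapping.single (pconcat q p) (f q))
      {q \<in> nonclosed_paths G. phead q = ptail p}) r =
    right_mult_coeff G (\<lambda>q. if q \<in> nonclosed_paths G then f q else 0) p r"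
proof -
  let ?A = "{q \<in> nonclosed_paths G. phead q = ptail p}"
  have concat: "is_concat G (pconcat q p) q p" if "q \<in> ?A" for q
    using p that by (simp add: is_concat_def nonclosed_paths_def)
  have fin': "finite {q \<in> ?A. f q \<noteq> 0}"
    using fin by (rule rev_finite_subset) (auto simp: nonclosed_paths_def)
  have inj: "inj_on (\<lambda>q. pconcat q p) ?A"
    using concat by (intro inj_onI) (metis is_concat_cancel_right)
  note lookup = lookup_sum'_single_inj[OF fin' inj]
  show ?thesis
  proof (cases "r \<in> (\<lambda>q. pconcat q p) ` ?A")
    case True
    then obtain q where q: "q \<in> ?A" "r = pconcat q p" by blast
    then show ?thesis
      using lookup(1)[OF q(1)]
        right_mult_coeff_concat[OF concat[OF q(1)], of "\<lambda>q. if q \<in> nonclosed_paths G then f q else 0"] by simp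
  next
    case False
    then have "right_mult_coeff G (\<lambda>q. if q \<in> nonclosed_paths G then f q else 0) p r = 0"
      by (intro right_mult_coeff_eq_0) (auto simp: is_concat_def)
    with lookup(2)[OF False] show ?thesis by simp
  qed
qed

lemma lookup_sum'_single_pconcat_left:
  assumes p: "p \<in> paths G" and fin: "finite {q \<in> paths G. f q \<noteq> 0}"
  shows "Poly_Mapping.lookup (sum' (\<lambda>q. Poly_Mapping.single (pconcat p q) (f q))
      {q \<in> nonclosed_paths G. ptail q = phead p}) r =
    left_mult_coeff G p (\<lambda>q. if q \<in> nonclosed_paths G then f q else 0) r"
proof -
  let ?A = "{q \<in> nonclosed_paths G. ptail q = phead p}"
  have concat: "is_concat G (pconcat p q) p q" if "q \<in> ?A" for q
    using p that by (simp add: is_concat_def nonclosed_paths_def)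
  have fin': "finite {q \<in> ?A. f q \<noteq> 0}"
    using fin by (rule rev_finite_subset) (auto simp: nonclosed_paths_def)
  have inj: "inj_on (\<lambda>q. pconcat p q) ?A"
    using concat by (intro inj_onI) (metis is_concat_cancel_left)
  note lookup = lookup_sum'_single_inj[OF fin' inj]
  show ?thesis
  proof (cases "r \<in> (\<lambda>q. pconcat p q) ` ?A")
    case True
    then obtain q where q: "q \<in> ?A" "r = pconcat p q" by blast
    then show ?thesis
      using lookup(1)[OF q(1)]
        left_mult_coeff_concat[OF concat[OF q(1)], of "\<lambda>q. if q \<in> nonclosed_paths G then f q else 0"] by simp
  next
    case False
    then have "left_mult_coeff G p (\<lambda>q. if q \<in> nonclosed_paths G then f q else 0) r = 0"
      by (intro left_mult_coeff_eq_0) (auto simp: is_concat_def)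
    with lookup(2)[OF False] show ?thesis by simp
  qed
qed

section \<open>Translation of the theorem into coefficients\<close>

theorem theorem2p3:
  fixes G :: "('v, 'e) pre_digraph"
    and D :: "(('v, 'e) path \<Rightarrow>\<^sub>0 'k::field) \<Rightarrow> (('v, 'e) path \<Rightarrow>\<^sub>0 'k)"
    and c :: "('v, 'e) path \<Rightarrow> ('v, 'e) path \<Rightarrow> 'k"
  assumes "fin_digraph G"
    and "linear_operator_on (path_algebra G) D"
    and "\<And>p. p \<in> paths G \<Longrightarrow> finite {q \<in> paths G. c p q \<noteq> 0}"
    and "\<And>p. p \<in> paths G \<Longrightarrow>
           D (Poly_Mapping.single p 1) = sum' (\<lambda>q. Poly_Mapping.single q (c p q)) (paths G)"
  shows "path_derivation G D \<longleftrightarrow>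
    (\<forall>v\<in>verts G.
       D (Poly_Mapping.single (vertex_path v) 1) =
         sum' (\<lambda>q. Poly_Mapping.single q (c (vertex_path v) q))
           {q \<in> nonclosed_paths G. ptail q = v}
       + sum' (\<lambda>q. Poly_Mapping.single q (c (vertex_path v) q))
           {q \<in> nonclosed_paths G. phead q = v}) \<and>
    (\<forall>p \<in> paths G - vertex_paths G.
       D (Poly_Mapping.single p 1) =
         sum' (\<lambda>q. Poly_Mapping.single (pconcat q p) (c (vertex_path (ptail p)) q))
           {q \<in> nonclosed_paths G. phead q = ptail p}
       + sum' (\<lambda>q. Poly_Mapping.single q (c p q))
           {q \<in> paths G. parallel_paths q p}
       + sum' (\<lambda>q. Poly_Mapping.single (pconcat p q) (c (vertex_path (phead p)) q))
           {q \<in> nonclosed_paths G. ptail q = phead p}) \<and>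
    (\<forall>q \<in> nonclosed_paths G.
       c (vertex_path (phead q)) q + c (vertex_path (ptail q)) q = 0) \<and>
    (\<forall>p1 \<in> paths G - vertex_paths G. \<forall>p2 \<in> paths G - vertex_paths G. \<forall>p q.
       is_concat G p p1 p2 \<and> q \<in> paths G \<and> parallel_paths q p \<longrightarrow>
         (\<forall>q1 q2. is_concat G q q1 p2 \<and> is_concat G q p1 q2 \<longrightarrow>
            c p q = c p1 q1 + c p2 q2) \<and>
         (\<forall>q1. is_concat G q q1 p2 \<and> \<not> le_tail G p1 q \<longrightarrow> c p q = c p1 q1) \<and>
         (\<forall>q2. is_concat G q p1 q2 \<and> \<not> le_head G p2 q \<longrightarrow> c p q = c p2 q2) \<and>
         (\<not> le_head G p2 q \<and> \<not> le_tail G p1 q \<longrightarrow> c p q = 0))"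
proof -
  interpret fin_digraph G by fact
  note D = assms(2) and fin = assms(3)
  have lookup_D: "Poly_Mapping.lookup (D (Poly_Mapping.single p 1)) r = (if r \<in> paths G then c p r else 0)"
    if "p \<in> paths G" for p r
    using that by (simp add: assms(4) lookup_sum'_single fin)
  have D_closed: "D (Poly_Mapping.single p 1) \<in> path_algebra G" if "p \<in> paths G" for p
    using D that by (simp add: linear_operator_on_def)
  \<comment> \<open>Needed for paths that do not meet, whose product is 0.\<close>
  have D_0: "D 0 = 0"
  proof -
    have "D (scale 0 0) = scale 0 (D 0)"
      using D path_algebra_0 unfolding linear_operator_on_def by blast
    then show ?thesis by simp
  qed
  have lookup_sub: "Poly_Mapping.lookup (sum' (\<lambda>q. Poly_Mapping.single q (c p q)) A) r =
      (if r \<in> A then c p r else 0)" if "p \<in> paths G" "A \<subseteq> paths G" for A p r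
    using that by (intro lookup_sum'_single finite_subset[OF _ fin[OF that(1)]]) auto
  have nonclosed_sub: "{q \<in> nonclosed_paths G. P q} \<subseteq> paths G" for P
    by (auto simp: nonclosed_paths_def)

  have derivation: "path_derivation G D \<longleftrightarrow> leibniz_coeffs G c"
  proof -
    have "D (path_mult (Poly_Mapping.single p 1) (Poly_Mapping.single q 1)) =
        path_mult (D (Poly_Mapping.single p 1)) (Poly_Mapping.single q 1) +
        path_mult (Poly_Mapping.single p 1) (D (Poly_Mapping.single q 1)) \<longleftrightarrow>
      (\<forall>r\<in>paths G. (if phead p = ptail q then c (pconcat p q) r else 0) =
        right_mult_coeff G (c p) q r + left_mult_coeff G p (c q) r)" (is "?L = ?R \<longleftrightarrow> ?coeffs")
      if p: "p \<in> paths G" and q: "q \<in> paths G" for p q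
    proof -
      have "Poly_Mapping.lookup ?L r = (if r \<in> paths G \<and> phead p = ptail q then c (pconcat p q) r else 0)" for r
        using p q by (simp add: path_mult_single lookup_D paths_pconcat D_0)
      moreover have "Poly_Mapping.lookup ?R r = right_mult_coeff G (c p) q r + left_mult_coeff G p (c q) r" for r
      proof -
        \<comment> \<open>Factors of r are paths, and on paths the coefficients of D(p) are those in
          \<open>c p\<close>.\<close>
        have "right_mult_coeff G (Poly_Mapping.lookup (D (Poly_Mapping.single p 1))) q r =
            right_mult_coeff G (c p) q r"
          using p by (intro right_mult_coeff_cong) (simp add: is_concat_def lookup_D)
        moreover have "left_mult_coeff G p (Poly_Mapping.lookup (D (Poly_Mapping.single q 1))) r =
            left_mult_coeff G p (c q) r"
          using q by (intro left_mult_coeff_cong) (simp add: is_concat_def lookup_D)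
        ultimately show ?thesis
          by (simp add: lookup_add lookup_path_mult_single_right[OF D_closed[OF p] q]
            lookup_path_mult_single_left[OF D_closed[OF q] p])
      qed
      ultimately show ?thesis
        \<comment> \<open>Equality in the algebra is tested at all triples; at those that are not
          paths both sides are 0.\<close>
        by (auto simp: poly_mapping_eq_iff fun_eq_iff right_mult_coeff_not_path left_mult_coeff_not_path
          simp del: split_paired_All)
    qed
    then show ?thesis
      unfolding path_derivation_iff_basis[OF D] leibniz_coeffs_def by (intro ball_cong refl)
  qed
  have vertex: "D (Poly_Mapping.single (vertex_path v) 1) =
        sum' (\<lambda>q. Poly_Mapping.single q (c (vertex_path v) q)) {q \<in> nonclosed_paths G. ptail q = v}
      + sum' (\<lambda>q. Poly_Mapping.single q (c (vertex_path v) q)) {q \<in> nonclosed_paths G. phead q = v} \<longleftrightarrow>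
    (\<forall>r\<in>paths G. c (vertex_path v) r =
      (if r \<in> nonclosed_paths G \<and> ptail r = v then c (vertex_path v) r else 0) +
      (if r \<in> nonclosed_paths G \<and> phead r = v then c (vertex_path v) r else 0))"
    (is "?L = ?R \<longleftrightarrow> _") if v: "v \<in> verts G" for v
  proof -
    have "Poly_Mapping.lookup ?R r =
      (if r \<in> nonclosed_paths G \<and> ptail r = v then c (vertex_path v) r else 0) +
      (if r \<in> nonclosed_paths G \<and> phead r = v then c (vertex_path v) r else 0)" for r
      using v by (simp add: lookup_add lookup_sub nonclosed_sub)
    moreover have "Poly_Mapping.lookup ?L r = (if r \<in> paths G then c (vertex_path v) r else 0)" for r
      using v by (simp add: lookup_D)
    ultimately show ?thesis
      by (auto simp: poly_mapping_eq_iff fun_eq_iff nonclosed_paths_def simp del: split_paired_All)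
  qed
  have nonvertex: "D (Poly_Mapping.single p 1) =
        sum' (\<lambda>q. Poly_Mapping.single (pconcat q p) (c (vertex_path (ptail p)) q))
          {q \<in> nonclosed_paths G. phead q = ptail p}
      + sum' (\<lambda>q. Poly_Mapping.single q (c p q)) {q \<in> paths G. parallel_paths q p}
      + sum' (\<lambda>q. Poly_Mapping.single (pconcat p q) (c (vertex_path (phead p)) q))
          {q \<in> nonclosed_paths G. ptail q = phead p} \<longleftrightarrow>
    (\<forall>r\<in>paths G. c p r =
      right_mult_coeff G (\<lambda>s. if s \<in> nonclosed_paths G then c (vertex_path (ptail p)) s else 0) p r +
      (if parallel_paths r p then c p r else 0) +
      left_mult_coeff G p (\<lambda>s. if s \<in> nonclosed_paths G then c (vertex_path (phead p)) s else 0) r)"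
    (is "?L = ?R \<longleftrightarrow> _") if "p \<in> paths G - vertex_paths G" for p
  proof -
    have p: "p \<in> paths G" using that by simp
    have "Poly_Mapping.lookup ?R r =
      right_mult_coeff G (\<lambda>s. if s \<in> nonclosed_paths G then c (vertex_path (ptail p)) s else 0) p r +
      (if r \<in> paths G \<and> parallel_paths r p then c p r else 0) +
      left_mult_coeff G p (\<lambda>s. if s \<in> nonclosed_paths G then c (vertex_path (phead p)) s else 0) r" for r
      using p by (simp add: lookup_add lookup_sum'_single_pconcat_right lookup_sum'_single_pconcat_left
        fin lookup_sub ptail_in_verts phead_in_verts)
    moreover have "Poly_Mapping.lookup ?L r = (if r \<in> paths G then c p r else 0)" for r
      using p by (simp add: lookup_D)
    ultimately show ?thesis
      by (auto simp: poly_mapping_eq_iff fun_eq_iff right_mult_coeff_not_path left_mult_coeff_not_path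
        simp del: split_paired_All)
  qed
  show ?thesis
    unfolding derivation leibniz_coeffs_iff concat_coeff_cases_iff
    by (intro conj_cong ball_cong refl vertex[symmetric] nonvertex[symmetric])
qed

end
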